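(* The coefficients $\beta_{n,k}$ are positive, i.e. $\beta_{n,k}>0$ for all integers $n\ge 1$ and $0\le k\le n-1$.
   Context: The polynomials $p_n(w)$, $n\ge 1$, are defined by $p_1(w)=1$ and the recurrence $p_{n+1}(w) = -(nw+3n-1)p_n(w) + (1+w)p_n'(w)$ for $n\ge 1$. Each $p_n$ has degree at most $n-1$, and the coefficients $\beta_{n,k}$ ($0\le k\le n-1$) are defined by $p_n(w) = (-1)^{n-1}\sum_{k=0}^{n-1}\beta_{n,k}w^k$. *)

theory Defs
  imports Complex_Main "HOL-Computational_Algebra.Polynomial"
begin

text \<open>The family is indexed by \<open>n \<ge> 1\<close>; the value at \<open>0\<close> is a dummy. In the last equation the
  index of the recurrence is \<open>Suc n\<close>, and \<open>[:a, b:]\<close> stands for \<open>a + b w\<close>.\<close>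

fun p :: "nat \<Rightarrow> real poly" where
  "p 0 = 0"
| "p (Suc 0) = 1"
| "p (Suc (Suc n)) =
     - ([:3 * real (Suc n) - 1, real (Suc n):] * p (Suc n)) + [:1, 1:] * pderiv (p (Suc n))"

lemma p_1: "p 1 = 1"
  by simp

lemma p_rec:
  assumes "n \<ge> 1"
  shows "p (n + 1) = - ([:3 * real n - 1, real n:] * p n) + [:1, 1:] * pderiv (p n)"
  using assms by (cases n) simp_all

definition \<beta> :: "nat \<Rightarrow> nat \<Rightarrow> real" where
  "\<beta> n k = (-1) ^ (n - 1) * coeff (p n) k"

lemma degree_p: "degree (p n) \<le> n - 1"
proof (induction n rule: p.induct)
  case (3 n)
  have "degree ([:3 * real (Suc n) - 1, real (Suc n):] * p (Suc n)) \<le> 1 + n"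
    using 3 by (intro order.trans[OF degree_mult_le] add_mono) auto
  moreover have "degree ([:1, 1:] * pderiv (p (Suc n))) \<le> 1 + n"
    using 3 by (intro order.trans[OF degree_mult_le] add_mono) (auto simp: degree_pderiv)
  ultimately show ?case
    unfolding p.simps by (intro degree_add_le) (simp_all only: degree_minus diff_Suc_1 plus_1_eq_Suc)
qed simp_all

text \<open>The defining expansion \<open>p\<^sub>n(w) = (-1)\<^sup>n\<^sup>-\<^sup>1 \<Sum>\<^sub>k \<beta>\<^sub>n\<^sub>k w\<^sup>k\<close>.\<close>

lemma p_eq_sum_beta:
  assumes "n \<ge> 1"
  shows "p n = smult ((-1) ^ (n - 1)) (\<Sum>k = 0..n - 1. monom (\<beta> n k) k)"
proof (rule poly_eqI)
  fix i
  have sq: "(-1 :: real) ^ (n - 1) * ((-1) ^ (n - 1) * c) = c" for c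
    by (simp flip: mult.assoc power_add)
  have "coeff (p n) i = 0" if "\<not> i \<le> n - 1"
    using that degree_p[of n] by (intro coeff_eq_0) linarith
  then show "coeff (p n) i = coeff (smult ((-1) ^ (n - 1)) (\<Sum>k = 0..n - 1. monom (\<beta> n k) k)) i"
    by (auto simp: coeff_sum \<beta>_def sq sum.delta)
qed

end

theory Submission
  imports Defs
begin

text \<open>The positivity becomes visible after the substitution \<open>u = 1 + w\<close>. Put
  \<open>q\<^sub>n(u) = (-1)\<^sup>n\<^sup>-\<^sup>1 p\<^sub>n(u - 1)\<close>. The recurrence for \<open>p\<^sub>n\<close> turns into
  \<open>q\<^sub>n\<^sub>+\<^sub>1 = (n u + 2 n - 1) q\<^sub>n - u q\<^sub>n'\<close>, and since \<open>u q'\<close> only multiplies the coefficient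
  of \<open>u\<^sup>k\<close> by \<open>k\<close>, the coefficients \<open>\<gamma>\<^sub>n\<^sub>,\<^sub>k\<close> of \<open>q\<^sub>n\<close> satisfy
  \<open>\<gamma>\<^sub>n\<^sub>+\<^sub>1\<^sub>,\<^sub>k = n \<gamma>\<^sub>n\<^sub>,\<^sub>k\<^sub>-\<^sub>1 + (2 n - 1 - k) \<gamma>\<^sub>n\<^sub>,\<^sub>k\<close>.
  Because \<open>q\<^sub>n\<close> has degree less than \<open>n\<close>, the factor \<open>2 n - 1 - k\<close> is positive wherever
  \<open>\<gamma>\<^sub>n\<^sub>,\<^sub>k\<close> is nonzero, so all \<open>\<gamma>\<^sub>n\<^sub>,\<^sub>k\<close> with \<open>k < n\<close> are positive. (In the powers of \<open>w\<close>
  themselves, the recurrence has the negative term \<open>- (k + 1) \<beta>\<^sub>n\<^sub>,\<^sub>k\<^sub>+\<^sub>1\<close>, which blocks this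
  argument.) Expanding the powers of \<open>1 + w\<close> in \<open>(-1)\<^sup>n\<^sup>-\<^sup>1 p\<^sub>n(w) = q\<^sub>n(1 + w)\<close> gives
  \<open>\<beta>\<^sub>n\<^sub>,\<^sub>k = \<Sum>\<^sub>j \<gamma>\<^sub>n\<^sub>,\<^sub>j (j choose k)\<close>, which is positive for \<open>k < n\<close>.\<close>

definition q :: "nat \<Rightarrow> real poly" where
  "q n = smult ((-1) ^ (n - 1)) (p n \<circ>\<^sub>p [:-1, 1:])"

lemma degree_q: "degree (q n) \<le> n - 1"
  using degree_p[of n] by (simp add: q_def degree_pcompose)

text \<open>Passing from \<open>w\<close> to \<open>u = 1 + w\<close> replaces the factor \<open>1 + w\<close> of the derivative by \<open>u\<close>, so
  that differentiation no longer lowers the exponents, and turns \<open>n w + 3 n - 1\<close> into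
  \<open>n u + 2 n - 1\<close>.\<close>

lemma q_Suc:
  assumes "n \<ge> 1"
  shows "q (Suc n) = [:2 * real n - 1, real n:] * q n - [:0, 1:] * pderiv (q n)"
proof -
  let ?s = "(-1 :: real) ^ (n - 1)" and ?r = "p n \<circ>\<^sub>p [:-1, 1:]"
  have "p (Suc n) \<circ>\<^sub>p [:-1, 1:] = - ([:2 * real n - 1, real n:] * ?r) + [:0, 1:] * pderiv ?r"
  proof -
    have "[:3 * real n - 1, real n:] \<circ>\<^sub>p [:-1, 1:] = [:2 * real n - 1, real n:]"
      "[:1, 1:] \<circ>\<^sub>p [:-1, 1:] = ([:0, 1:] :: real poly)"
      by (simp_all add: pcompose_pCons)
    moreover have "pderiv ?r = pderiv (p n) \<circ>\<^sub>p [:-1, 1:]"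
      by (simp add: pderiv_pcompose pderiv_pCons)
    ultimately show ?thesis
      using p_rec[OF assms] by (simp only: Suc_eq_plus1 pcompose_add pcompose_uminus pcompose_mult)
  qed
  moreover have "(-1 :: real) ^ (Suc n - 1) = - ?s"
    using assms by (cases n) simp_all
  ultimately show ?thesis
    by (simp add: q_def pderiv_smult smult_add_right smult_diff_right del: mult_pCons_left)
qed

lemma coeff_q_Suc:
  assumes "n \<ge> 1"
  shows "coeff (q (Suc n)) k =
    (if k = 0 then 0 else real n * coeff (q n) (k - 1))
      + (2 * real n - 1 - real k) * coeff (q n) k"
  unfolding q_Suc[OF assms]
  by (cases k) (simp_all add: coeff_pderiv algebra_simps)

text \<open>By induction on \<open>n\<close>, each coefficient of \<open>q\<^sub>n\<^sub>+\<^sub>1\<close> is a combination of positive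
  coefficients of \<open>q\<^sub>n\<close> with positive weights \<open>n\<close> and \<open>2 n - 1 - k \<ge> n\<close> (for \<open>k < n\<close>).\<close>

lemma coeff_q_pos:
  assumes "k < n"
  shows "coeff (q n) k > 0"
  using assms
proof (induction n arbitrary: k)
  case (Suc n)
  show ?case
  proof (cases "n = 0")
    case True
    with Suc.prems show ?thesis by (simp add: q_def)
  next
    case False
    \<comment> \<open>The top coefficient \<open>k = n\<close> comes from the first summand alone, the constant one from
      the second alone.\<close>
    have "(2 * real n - 1 - real k) * coeff (q n) k > 0" if "k < n"
      using that Suc.IH[of k] by (intro mult_pos_pos) linarith+
    moreover have "coeff (q n) n = 0"
      using degree_q[of n] False by (intro coeff_eq_0) linarith
    moreover have "real n * coeff (q n) (k - 1) > 0" if "k \<noteq> 0"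
      using that Suc False by (intro mult_pos_pos) auto
    ultimately show ?thesis
      using Suc.prems False coeff_q_Suc[of n k]
      by (cases "k = n"; cases "k = 0") (auto intro: add_pos_pos simp: less_Suc_eq)
  qed
qed simp

lemma pcompose_power:
  fixes r s :: "'a :: comm_semiring_1 poly"
  shows "(r ^ m) \<circ>\<^sub>p s = (r \<circ>\<^sub>p s) ^ m"
  by (induction m) (simp_all add: pcompose_1 pcompose_mult)

lemma coeff_one_plus_X_power: "coeff ([:1, 1:] ^ j) k = (of_nat (j choose k) :: real)"
  by (cases "k \<le> j") (simp_all add: coeff_linear_poly_power coeff_eq_0 degree_linear_power)

lemma beta_eq_sum_binomial:
  "\<beta> n k = (\<Sum>j\<le>n - 1. coeff (q n) j * real (j choose k))"
proof -
  have "smult ((-1) ^ (n - 1)) (p n) = q n \<circ>\<^sub>p [:1, 1:]"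
    by (simp add: q_def pcompose_smult pcompose_pCons flip: pcompose_assoc)
  also have "\<dots> = (\<Sum>j\<le>n - 1. monom (coeff (q n) j) j) \<circ>\<^sub>p [:1, 1:]"
    by (simp only: poly_as_sum_of_monoms'[OF degree_q])
  also have "\<dots> = (\<Sum>j\<le>n - 1. smult (coeff (q n) j) ([:1, 1:] ^ j))"
    by (simp add: pcompose_sum pcompose_smult pcompose_power pcompose_pCons monom_altdef)
  finally have "coeff (smult ((-1) ^ (n - 1)) (p n)) k = coeff \<dots> k"
    by (rule arg_cong)
  then show ?thesis
    by (simp add: \<beta>_def coeff_sum coeff_one_plus_X_power)
qed

theorem theorem3p4:
  fixes n k :: nat
  assumes "n \<ge> 1" and "k \<le> n - 1"
  shows "\<beta> n k > 0"
  unfolding beta_eq_sum_binomial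
proof (rule sum_pos2[of _ k])
  show "coeff (q n) k * real (k choose k) > 0"
    using assms by (simp add: coeff_q_pos)
  show "coeff (q n) j * real (j choose k) \<ge> 0" if "j \<in> {..n - 1}" for j
  proof -
    have "j < n"
      using that assms by auto
    from coeff_q_pos[OF this] show ?thesis
      by simp
  qed
qed (use assms in simp_all)

end
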